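(* Let $(G,X)$ be a $G$-system with $G$ a discrete infinite abelian (hence amenable) group and $(X,d)$ a compact metric space, let $\mathcal{F}$ be a F{\o}lner net in $G$, and let $x\in X$. Suppose that $\mathcal{C}_{\mathcal{F}}(x)$ is S-generic and is not a minimal subset of $(G,X)$, and that the almost periodic points of $(G,X)$ lying in $\mathcal{C}_{\mathcal{F}}(x)$ are dense in $\mathcal{C}_{\mathcal{F}}(x)$. Then there is an infinite countable subset $K$ of $\mathcal{C}_{\mathcal{F}}(x)$ such that for every $\hat{x}\in\mathcal{C}_{\mathcal{F}}(x)$, every $n\ge 2$, any $n$ distinct points $x_1,\ldots,x_n\in K$, any neighborhood $U$ of $\hat{x}$ and any neighborhoods $U_i$ of $x_i$ in $X$ ($1\le i\le n$), there exist $n$ points $y_1,\ldots,y_n\in U$ and some $g\in G$ with $gy_i\in U_i$ for all $1\leq i\leq n$.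
   Context: A $G$-system $(G,X)$: $G$ is a discrete infinite amenable group with identity $e$, $(X,d)$ is a compact metric space, and $G$ acts on $X$ from the left by continuous transformations ($ex=x$, $(gf)x=g(fx)$). A set $\Lambda\subseteq X$ is $G$-invariant if $g\Lambda\subseteq\Lambda$ for all $g\in G$. A nonempty closed $G$-invariant set is minimal if the orbit of each of its points is dense in it. A subset $P\subseteq G$ is syndetic if there is a finite $F\subset G$ with $F^{-1}P=\bigcup_{g\in F}g^{-1}P=G$. A point $p\in X$ is almost periodic if $\{g\in G\mid gp\in U\}$ is syndetic for every neighborhood $U$ of $p$. A (left) F{\o}lner net in $G$ is a net $\mathcal{F}=\{F_n\}_{n\in D}$ of (nonempty) finite subsets of $G$ with $\lim_{n\in D}|gF_n\vartriangle F_n|/|F_n|=0$ for all $g\in G$. For $A\subseteq G$, $\overline{d}_{\mathcal{F}}(A)=\sup\{\alpha \mid \forall m\in D\ \exists n\ge m:\ |A\cap F_n|/|F_n|\ge\alpha\}$ and $\underline{d}_{\mathcal{F}}(A)=\sup\{\alpha \mid \exists m\in D\ \forall n\ge m:\ |A\cap F_n|/|F_n|\ge\alpha\}$; if they coincide the common value is $d_{\mathcal{F}}(A)$. A closed set $C\subseteq X$ is an $\mathcal{F}$-center of attraction of $x$ if $d_{\mathcal{F}}(\{g\in G\mid gx\in B_\epsilon(C)\})=1$ for all $\epsilon>0$, where $B_\epsilon(C)$ is the $\epsilon$-neighborhood of $C$. The minimal one (no proper subset of which is an $\mathcal{F}$-center of attraction of $x$), which exists and is unique, is denoted $\mathcal{C}_{\mathcal{F}}(x)$.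 A $G$-invariant set $\Lambda\subseteq X$ is S-generic (relative to $\mathcal{F}$) if there is $y\in\Lambda$ with $\Lambda=\mathcal{C}_{\mathcal{F}}(y)$. *)

theory Defs
  imports "HOL-Analysis.Analysis"
begin

(* The discrete group G is the type 'g, written additively: e is 0, the product gf is g + f and
   the inverse of g is -g.  Commutativity is only assumed where the class ab_group_add is used;
   no definition below depends on it.  The space X is the whole type 'x. *)

definition G_system :: "('g::group_add \<Rightarrow> 'x::metric_space \<Rightarrow> 'x) \<Rightarrow> bool" where
  "G_system act \<longleftrightarrow>
     compact (UNIV :: 'x set) \<and>
     (\<forall>x. act 0 x = x) \<and>
     (\<forall>g f x. act (g + f) x = act g (act f x)) \<and>
     (\<forall>g. continuous_on UNIV (act g))"

definition G_invariant :: "('g \<Rightarrow> 'x \<Rightarrow> 'x) \<Rightarrow> 'x set \<Rightarrow> bool" where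
  "G_invariant act \<Lambda> \<longleftrightarrow> (\<forall>g. act g ` \<Lambda> \<subseteq> \<Lambda>)"

definition minimal_subset :: "('g \<Rightarrow> 'x::metric_space \<Rightarrow> 'x) \<Rightarrow> 'x set \<Rightarrow> bool" where
  "minimal_subset act \<Lambda> \<longleftrightarrow>
     \<Lambda> \<noteq> {} \<and> closed \<Lambda> \<and> G_invariant act \<Lambda> \<and>
     (\<forall>p\<in>\<Lambda>. closure (range (\<lambda>g. act g p)) = \<Lambda>)"

definition syndetic :: "'g::group_add set \<Rightarrow> bool" where
  "syndetic P \<longleftrightarrow> (\<exists>F. finite F \<and> (\<Union>g\<in>F. (\<lambda>h. - g + h) ` P) = UNIV)"

(* Neighborhoods need not be open: U is a neighborhood of p iff p \<in> interior U. *)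

definition almost_periodic :: "('g::group_add \<Rightarrow> 'x::metric_space \<Rightarrow> 'x) \<Rightarrow> 'x \<Rightarrow> bool" where
  "almost_periodic act p \<longleftrightarrow> (\<forall>U. p \<in> interior U \<longrightarrow> syndetic {g. act g p \<in> U})"

(* The index set of a net is a type of class preorder, with directedness required explicitly;
   the filter (INF m. principal {m..}) expresses convergence along it. *)

definition folner_net :: "('d::preorder \<Rightarrow> 'g::group_add set) \<Rightarrow> bool" where
  "folner_net F \<longleftrightarrow>
     (\<forall>a b :: 'd. \<exists>c. a \<le> c \<and> b \<le> c) \<and>
     (\<forall>n. finite (F n) \<and> F n \<noteq> {}) \<and>
     (\<forall>g. ((\<lambda>n. real (card (sym_diff ((\<lambda>h. g + h) ` F n) (F n))) / real (card (F n))) \<longlongrightarrow> 0)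
            (INF m. principal {m..}))"

definition upper_density :: "('d::preorder \<Rightarrow> 'g set) \<Rightarrow> 'g set \<Rightarrow> real" where
  "upper_density F A =
     Sup {\<alpha>. \<forall>m. \<exists>n\<ge>m. real (card (A \<inter> F n)) / real (card (F n)) \<ge> \<alpha>}"

definition lower_density :: "('d::preorder \<Rightarrow> 'g set) \<Rightarrow> 'g set \<Rightarrow> real" where
  "lower_density F A =
     Sup {\<alpha>. \<exists>m. \<forall>n\<ge>m. real (card (A \<inter> F n)) / real (card (F n)) \<ge> \<alpha>}"

definition has_density :: "('d::preorder \<Rightarrow> 'g set) \<Rightarrow> 'g set \<Rightarrow> real \<Rightarrow> bool" where
  "has_density F A a \<longleftrightarrow> upper_density F A = a \<and> lower_density F A = a"

definition center_of_attraction ::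
  "('d::preorder \<Rightarrow> 'g set) \<Rightarrow> ('g \<Rightarrow> 'x::metric_space \<Rightarrow> 'x) \<Rightarrow> 'x \<Rightarrow> 'x set \<Rightarrow> bool" where
  "center_of_attraction F act x C \<longleftrightarrow>
     closed C \<and> (\<forall>\<epsilon>>0. has_density F {g. act g x \<in> (\<Union>c\<in>C. ball c \<epsilon>)} 1)"

definition minimal_center_of_attraction ::
  "('d::preorder \<Rightarrow> 'g set) \<Rightarrow> ('g \<Rightarrow> 'x::metric_space \<Rightarrow> 'x) \<Rightarrow> 'x \<Rightarrow> 'x set \<Rightarrow> bool" where
  "minimal_center_of_attraction F act x C \<longleftrightarrow>
     center_of_attraction F act x C \<and> (\<forall>C'. C' \<subset> C \<longrightarrow> \<not> center_of_attraction F act x C')"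

(* Well defined by ex1_minimal_center_of_attraction below. *)

definition min_center ::
  "('d::preorder \<Rightarrow> 'g set) \<Rightarrow> ('g \<Rightarrow> 'x::metric_space \<Rightarrow> 'x) \<Rightarrow> 'x \<Rightarrow> 'x set" where
  "min_center F act x = (THE C. minimal_center_of_attraction F act x C)"

definition S_generic ::
  "('d::preorder \<Rightarrow> 'g set) \<Rightarrow> ('g \<Rightarrow> 'x::metric_space \<Rightarrow> 'x) \<Rightarrow> 'x set \<Rightarrow> bool" where
  "S_generic F act \<Lambda> \<longleftrightarrow> G_invariant act \<Lambda> \<and> (\<exists>y\<in>\<Lambda>. \<Lambda> = min_center F act y)"

context
  fixes F :: "'d::preorder \<Rightarrow> 'g set"
  assumes dir: "\<And>a b :: 'd. \<exists>c. a \<le> c \<and> b \<le> c"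
    and fin: "\<And>n. finite (F n)" and ne: "\<And>n. F n \<noteq> {}"
begin

lemma ratio_le_1: "real (card (A \<inter> F n)) / real (card (F n)) \<le> 1"
  using fin[of n] ne[of n] by (simp add: divide_le_eq card_gt_0_iff card_mono)

lemma ratio_compl:
  "real (card (- A \<inter> F n)) / real (card (F n)) = 1 - real (card (A \<inter> F n)) / real (card (F n))"
proof -
  have "card (F n) = card (A \<inter> F n) + card (- A \<inter> F n)"
    using fin[of n] by (subst card_Un_disjoint[symmetric]) (auto intro: arg_cong[where f = card])
  then have "real (card (- A \<inter> F n)) = real (card (F n)) - real (card (A \<inter> F n))" by simp
  then show ?thesis using fin[of n] ne[of n] by (simp add: diff_divide_distrib)
qed

lemma has_density_1_iff:
  "has_density F A 1 \<longleftrightarrow>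
     (\<forall>\<beta><1. \<exists>m. \<forall>n\<ge>m. real (card (A \<inter> F n)) / real (card (F n)) \<ge> \<beta>)"
proof -
  let ?r = "\<lambda>n. real (card (A \<inter> F n)) / real (card (F n))"
  let ?L = "{\<alpha>. \<exists>m. \<forall>n\<ge>m. ?r n \<ge> \<alpha>}" and ?U = "{\<alpha>. \<forall>m. \<exists>n\<ge>m. ?r n \<ge> \<alpha>}"
  have LU: "?L \<subseteq> ?U"
  proof clarify
    fix \<alpha> a b assume a: "\<forall>n\<ge>a. \<alpha> \<le> ?r n"
    obtain c where "a \<le> c" "b \<le> c" using dir by blast
    with a show "\<exists>n\<ge>b. \<alpha> \<le> ?r n" by blast
  qed
  have U1: "\<alpha> \<le> 1" if U: "\<alpha> \<in> ?U" for \<alpha>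
  proof -
    obtain n where "\<alpha> \<le> ?r n" using U by blast
    then show ?thesis using ratio_le_1[of A n] by linarith
  qed
  have L0: "0 \<in> ?L" by simp
  have bU: "bdd_above ?U" using U1 by (intro bdd_aboveI[of _ 1])
  have bL: "bdd_above ?L" using bU LU by (rule bdd_above_mono)
  show ?thesis
  proof
    assume "has_density F A 1"
    then have S: "Sup ?L = 1" by (simp add: has_density_def lower_density_def)
    show "\<forall>\<beta><1. \<exists>m. \<forall>n\<ge>m. ?r n \<ge> \<beta>"
    proof (intro allI impI)
      fix \<beta> :: real assume "\<beta> < 1"
      then have "\<beta> < Sup ?L" using S by simp
      moreover have "?L \<noteq> {}" using L0 by blast
      ultimately obtain \<alpha> where \<alpha>: "\<alpha> \<in> ?L" "\<beta> < \<alpha>" by (rule less_cSupE)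
      from \<alpha>(1) obtain m where m: "\<forall>n\<ge>m. ?r n \<ge> \<alpha>" by blast
      have "?r n \<ge> \<beta>" if "n \<ge> m" for n using m that \<alpha>(2) by fastforce
      then show "\<exists>m. \<forall>n\<ge>m. ?r n \<ge> \<beta>" by blast
    qed
  next
    assume H: "\<forall>\<beta><1. \<exists>m. \<forall>n\<ge>m. ?r n \<ge> \<beta>"
    have "Sup ?L \<ge> 1"
    proof (rule dense_le)
      fix \<beta> :: real assume "\<beta> < 1"
      with H have "\<beta> \<in> ?L" by blast
      then show "\<beta> \<le> Sup ?L" using bL by (rule cSup_upper)
    qed
    moreover have "Sup ?L \<le> Sup ?U" using L0 LU bU by (intro cSup_subset_mono) blast+
    moreover have "Sup ?U \<le> 1" using L0 LU U1 by (intro cSup_least) blast+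
    ultimately show "has_density F A 1"
      by (simp add: has_density_def lower_density_def upper_density_def)
  qed
qed

definition null_set :: "'g set \<Rightarrow> bool" where
  "null_set A \<longleftrightarrow> (\<forall>\<epsilon>>0. \<exists>m. \<forall>n\<ge>m. real (card (A \<inter> F n)) / real (card (F n)) \<le> \<epsilon>)"

lemma has_density_1_iff_null_set: "has_density F A 1 \<longleftrightarrow> null_set (- A)"
proof -
  have "(\<forall>\<beta><1. P \<beta>) \<longleftrightarrow> (\<forall>\<epsilon>>0. P (1 - \<epsilon>))" for P :: "real \<Rightarrow> bool"
    by (metis add_diff_cancel_left' diff_gt_0_iff_gt diff_add_cancel less_add_same_cancel1)
  then show ?thesis
    unfolding has_density_1_iff null_set_def ratio_compl by (simp add: algebra_simps)
qed

lemma null_set_mono: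
  assumes "null_set B" "A \<subseteq> B"
  shows "null_set A"
proof -
  have "real (card (A \<inter> F n)) / real (card (F n)) \<le> real (card (B \<inter> F n)) / real (card (F n))" for n
    using assms(2) fin[of n] by (intro divide_right_mono) (auto intro!: card_mono)
  then show ?thesis using assms(1) unfolding null_set_def by (meson order_trans)
qed

lemma null_set_Un:
  assumes "null_set A" "null_set B"
  shows "null_set (A \<union> B)"
  unfolding null_set_def
proof (intro allI impI)
  fix \<epsilon> :: real assume "\<epsilon> > 0"
  then have "\<epsilon> / 2 > 0" by simp
  then obtain a b where
    a: "\<And>n. n \<ge> a \<Longrightarrow> real (card (A \<inter> F n)) / real (card (F n)) \<le> \<epsilon> / 2" and
    b: "\<And>n. n \<ge> b \<Longrightarrow> real (card (B \<inter> F n)) / real (card (F n)) \<le> \<epsilon> / 2"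
    using assms unfolding null_set_def by meson
  obtain c where c: "a \<le> c" "b \<le> c" using dir by blast
  have "real (card ((A \<union> B) \<inter> F n)) / real (card (F n)) \<le> \<epsilon>" if "n \<ge> c" for n
  proof -
    have "card ((A \<union> B) \<inter> F n) \<le> card (A \<inter> F n) + card (B \<inter> F n)"
      by (metis Int_Un_distrib2 card_Un_le)
    then have "real (card ((A \<union> B) \<inter> F n)) / real (card (F n))
        \<le> (real (card (A \<inter> F n)) + real (card (B \<inter> F n))) / real (card (F n))"
      by (intro divide_right_mono) auto
    also have "\<dots> \<le> \<epsilon> / 2 + \<epsilon> / 2"
      unfolding add_divide_distrib using a[of n] b[of n] c that order_trans by (intro add_mono) blast+
    finally show ?thesis by simp
  qed
  then show "\<exists>m. \<forall>n\<ge>m. real (card ((A \<union> B) \<inter> F n)) / real (card (F n)) \<le> \<epsilon>" by blast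
qed

lemma null_set_UN: "finite I \<Longrightarrow> (\<And>i. i \<in> I \<Longrightarrow> null_set (A i)) \<Longrightarrow> null_set (\<Union>i\<in>I. A i)"
proof (induction I rule: finite_induct)
  case empty
  show ?case by (auto simp: null_set_def intro: less_imp_le)
qed (simp add: null_set_Un)

lemma ex1_minimal_center_of_attraction_aux:
  fixes act :: "'g \<Rightarrow> 'x::metric_space \<Rightarrow> 'x"
  assumes comp: "compact (UNIV :: 'x set)"
  shows "\<exists>!C. minimal_center_of_attraction F act x C"
proof -
  define N where "N y \<epsilon> \<longleftrightarrow> null_set {g. act g x \<in> ball y \<epsilon>}" for y and \<epsilon> :: real
  define C0 where "C0 = {y. \<forall>\<epsilon>>0. \<not> N y \<epsilon>}"
  have center: "center_of_attraction F act x C \<longleftrightarrow>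
      closed C \<and> (\<forall>\<epsilon>>0. null_set {g. act g x \<notin> (\<Union>c\<in>C. ball c \<epsilon>)})" for C
    unfolding center_of_attraction_def has_density_1_iff_null_set
    by (simp add: Collect_neg_eq[symmetric])
  have sub: "C0 \<subseteq> C" if C: "center_of_attraction F act x C" for C
  proof
    fix y assume y: "y \<in> C0"
    show "y \<in> C"
    proof (rule ccontr)
      assume "y \<notin> C"
      then obtain e where e: "e > 0" "ball y e \<inter> C = {}"
        using C open_contains_ball[of "- C"] unfolding center_of_attraction_def open_Compl
        by (metis ComplI disjoint_eq_subset_Compl open_Compl)
      have "{g. act g x \<in> ball y (e/2)} \<subseteq> {g. act g x \<notin> (\<Union>c\<in>C. ball c (e/2))}"
      proof clarsimp
        fix g c assume "dist y (act g x) * 2 < e" "c \<in> C" "dist c (act g x) * 2 < e"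
        then have "dist y c < e" using dist_triangle2[of y c "act g x"] by linarith
        then show False using e \<open>c \<in> C\<close> by auto
      qed
      moreover have "null_set {g. act g x \<notin> (\<Union>c\<in>C. ball c (e/2))}"
        using C e(1) unfolding center by (meson half_gt_zero)
      ultimately have "N y (e/2)" unfolding N_def using null_set_mono by blast
      then show False using y e by (auto simp: C0_def)
    qed
  qed
  have cl: "closed C0"
    unfolding closed_def open_contains_ball
  proof
    fix y assume "y \<in> - C0"
    then obtain e where e: "e > 0" "N y e" by (auto simp: C0_def)
    have "z \<in> - C0" if "z \<in> ball y (e/2)" for z
    proof -
      have "ball z (e/2) \<subseteq> ball y e"
      proof
        fix w assume "w \<in> ball z (e/2)"
        then show "w \<in> ball y e" using that dist_triangle[of y w z] by simp
      qed
      then have "N z (e/2)" using e unfolding N_def by (elim null_set_mono) auto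
      then show ?thesis using e by (auto simp: C0_def intro!: exI[of _ "e/2"])
    qed
    then show "\<exists>d>0. ball y d \<subseteq> - C0" using e by (intro exI[of _ "e/2"]) auto
  qed
  have "null_set {g. act g x \<notin> (\<Union>c\<in>C0. ball c \<epsilon>)}" if "\<epsilon> > 0" for \<epsilon>
  proof -
    let ?K = "UNIV - (\<Union>c\<in>C0. ball c \<epsilon>)"
    have K: "compact ?K" using comp by (rule compact_diff) auto
    have "\<forall>y\<in>?K. \<exists>e>0. N y e" using that by (fastforce simp: C0_def)
    then obtain r where r: "\<And>y. y \<in> ?K \<Longrightarrow> r y > 0 \<and> N y (r y)" by metis
    have "?K \<subseteq> (\<Union>y\<in>?K. ball y (r y))" using r centre_in_ball by blast
    then obtain I where I: "I \<subseteq> ?K" "finite I" "?K \<subseteq> (\<Union>y\<in>I. ball y (r y))"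
      by (rule compactE_image[OF K open_ball, of "\<lambda>y. y" r ?K])
    have "null_set (\<Union>y\<in>I. {g. act g x \<in> ball y (r y)})"
      using I r by (intro null_set_UN) (auto simp: N_def subset_iff)
    then show ?thesis by (rule null_set_mono) (use I in blast)
  qed
  then have C0: "center_of_attraction F act x C0" using cl center by blast
  show ?thesis
    unfolding minimal_center_of_attraction_def 
  proof (rule ex1I[of _ C0])
    show "center_of_attraction F act x C0 \<and> (\<forall>C'\<subset>C0. \<not> center_of_attraction F act x C')"
      using C0 sub by (auto dest: sub)
  next
    fix C
    assume "center_of_attraction F act x C \<and> (\<forall>C'\<subset>C. \<not> center_of_attraction F act x C')"
    then show "C = C0" using C0 sub[of C] by auto
  qed
qed

end

lemma ex1_minimal_center_of_attraction:
  fixes act :: "'g::group_add \<Rightarrow> 'x::metric_space \<Rightarrow> 'x" and F :: "'d::preorder \<Rightarrow> 'g set"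
  assumes "G_system act" and "folner_net F"
  shows "\<exists>!C. minimal_center_of_attraction F act x C"
proof (rule ex1_minimal_center_of_attraction_aux)
  show "\<exists>c. a \<le> c \<and> b \<le> c" for a b :: 'd
    using assms(2) unfolding folner_net_def by blast
  show "finite (F n)" "F n \<noteq> {}" for n
    using assms(2) unfolding folner_net_def by blast+
  show "compact (UNIV :: 'x set)"
    using assms(1) unfolding G_system_def by blast
qed

end

theory Submission
  imports Defs "HOL-Library.Diagonal_Subsequence"
begin

text \<open>
  Write \<open>\<Lambda>\<close> for the center, generic for \<open>y \<in> \<Lambda>\<close>. The orbit closure of \<open>y\<close> is itself a center of
  attraction, so it equals \<open>\<Lambda>\<close> and \<open>\<Lambda>\<close> is topologically transitive. Density of the almost periodic
  points then makes every set of hitting times \<open>{g. g U \<inter> V \<noteq> {}}\<close> syndetic, and if \<open>V\<close> contains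
  a closed invariant subset of \<open>\<Lambda>\<close> even thickly syndetic; thickly syndetic sets are stable under
  finite intersection. As \<open>\<Lambda>\<close> is not minimal, it contains infinitely many pairwise disjoint orbit
  closures \<open>M 0, M 1, \<dots>\<close> of almost periodic points. Hence for every \<open>k\<close> a single \<open>g k\<close> carries
  points of the \<open>1/k\<close>-ball around \<open>y\<close> to within \<open>1/k\<close> of each of \<open>M 0, \<dots>, M k\<close>. A diagonal
  subsequence of the images converges to points \<open>x i \<in> M i\<close>, and these form \<open>K\<close>. The
  neighbourhood of \<open>y\<close> is transported to any other point of \<open>\<Lambda>\<close> along the dense orbit of \<open>y\<close>.
\<close>

section \<open>Syndetic and thickly syndetic subsets of a group\<close>

lemma syndetic_iff: "syndetic P \<longleftrightarrow> (\<exists>F. finite F \<and> (\<forall>g. \<exists>f\<in>F. f + g \<in> P))"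
proof -
  have "g \<in> (\<lambda>h. - f + h) ` P \<longleftrightarrow> f + g \<in> P" for f g :: 'a
    by (metis (no_types, lifting) add_minus_cancel image_iff minus_add_cancel)
  then have "(\<Union>f\<in>F. (\<lambda>h. - f + h) ` P) = UNIV \<longleftrightarrow> (\<forall>g. \<exists>f\<in>F. f + g \<in> P)" for F
    by (simp add: set_eq_iff)
  then show ?thesis by (simp add: syndetic_def)
qed

lemma syndetic_mono: "syndetic P \<Longrightarrow> P \<subseteq> Q \<Longrightarrow> syndetic Q"
  unfolding syndetic_iff by (meson subsetD)

lemma syndetic_translate:
  assumes "syndetic P"
  shows "syndetic ((+) a ` P)"
proof -
  obtain F where F: "finite F" "\<And>g. \<exists>f\<in>F. f + g \<in> P"
    using assms unfolding syndetic_iff by blast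
  have "\<exists>f\<in>(+) a ` F. f + g \<in> (+) a ` P" for g
    using F(2)[of g] by (auto simp: add.assoc)
  then show ?thesis
    unfolding syndetic_iff using F(1) by blast
qed

text \<open>Syndeticity alone can be lost under intersection, as with the even and the odd integers.
  Asking for syndetically many places with room for any finite pattern \<open>E\<close> repairs
  this.\<close>

definition thickly_syndetic :: "'g::group_add set \<Rightarrow> bool" where
  "thickly_syndetic A \<longleftrightarrow> (\<forall>E. finite E \<longrightarrow> syndetic {g. \<forall>e\<in>E. e + g \<in> A})"

lemma thickly_syndetic_imp_syndetic: "thickly_syndetic A \<Longrightarrow> syndetic A"
  unfolding thickly_syndetic_def by (drule spec[of _ "{0}"]) simp_all

lemma thickly_syndeticE:
  assumes "thickly_syndetic A" "finite E"
  obtains S where "finite S" "\<And>g. \<exists>s\<in>S. \<forall>e\<in>E. e + (s + g) \<in> A"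
  using assms unfolding thickly_syndetic_def syndetic_iff by auto

lemma thickly_syndetic_UNIV: "thickly_syndetic (UNIV :: 'g::group_add set)"
proof -
  have "finite {0} \<and> (\<forall>g :: 'g. \<exists>f\<in>{0}. f + g \<in> UNIV)" by simp
  then have "syndetic (UNIV :: 'g set)" unfolding syndetic_iff by (rule exI)
  then show ?thesis by (simp add: thickly_syndetic_def)
qed

text \<open>The pattern demanded of \<open>A\<close> is enlarged from \<open>E\<close> to
  \<open>E + S\<close>, where \<open>S\<close> holds the shifts that may be needed to reach
  \<open>B\<close>. After a shift \<open>t\<close> that makes \<open>A\<close> good for the large
  pattern, the further shift \<open>s\<close> for \<open>B\<close> does not leave
  \<open>A\<close>.\<close>

lemma thickly_syndetic_Int:
  assumes "thickly_syndetic A" "thickly_syndetic B"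
  shows "thickly_syndetic (A \<inter> B)"
  unfolding thickly_syndetic_def
proof (intro allI impI)
  fix E :: "'a set" assume E: "finite E"
  from thickly_syndeticE[OF assms(2) E] obtain S
    where S: "finite S" "\<And>g. \<exists>s\<in>S. \<forall>e\<in>E. e + (s + g) \<in> B" by blast
  let ?E = "(\<lambda>(e, s). e + s) ` (E \<times> S)"
  have "finite ?E" using E S(1) by simp
  from thickly_syndeticE[OF assms(1) this] obtain T
    where T: "finite T" "\<And>g. \<exists>t\<in>T. \<forall>e\<in>?E. e + (t + g) \<in> A" by blast
  have "\<exists>r\<in>(\<lambda>(s, t). s + t) ` (S \<times> T). \<forall>e\<in>E. e + (r + g) \<in> A \<inter> B" for g
  proof -
    obtain t where t: "t \<in> T" "\<forall>e\<in>?E. e + (t + g) \<in> A" using T(2) by blast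
    obtain s where s: "s \<in> S" "\<forall>e\<in>E. e + (s + (t + g)) \<in> B" using S(2) by blast
    have "e + (s + (t + g)) \<in> A" if "e \<in> E" for e
      using t(2) that s(1) by (force simp: add.assoc)
    then show ?thesis
      using s t(1) by (intro bexI[of _ "s + t"]) (auto simp: add.assoc)
  qed
  moreover have "finite ((\<lambda>(s, t). s + t) ` (S \<times> T))" using S(1) T(1) by simp
  ultimately show "syndetic {g. \<forall>e\<in>E. e + g \<in> A \<inter> B}"
    unfolding syndetic_iff mem_Collect_eq by blast
qed

lemma thickly_syndetic_INT:
  "finite I \<Longrightarrow> (\<And>i. i \<in> I \<Longrightarrow> thickly_syndetic (A i)) \<Longrightarrow> thickly_syndetic (\<Inter>i\<in>I. A i)"
  by (induction I rule: finite_induct) (simp_all add: thickly_syndetic_UNIV thickly_syndetic_Int)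

section \<open>Diagonal extraction of convergent subsequences\<close>

lemma diagonal_convergent_subsequence:
  fixes w :: "nat \<Rightarrow> nat \<Rightarrow> 'x::metric_space"
  assumes "compact (UNIV :: 'x set)"
  shows "\<exists>r l. strict_mono r \<and> (\<forall>i. (\<lambda>k. w (r k) i) \<longlonglongrightarrow> l i)"
proof -
  interpret subseqs "\<lambda>i r. \<exists>l. (\<lambda>k. w (r k) i) \<longlonglongrightarrow> l"
  proof
    fix i and s :: "nat \<Rightarrow> nat"
    obtain l r where "strict_mono r" "((\<lambda>k. w (s k) i) \<circ> r) \<longlonglongrightarrow> l"
      using assms unfolding compact_def by (metis UNIV_I)
    then show "\<exists>r. strict_mono r \<and> (\<exists>l. (\<lambda>k. w ((s \<circ> r) k) i) \<longlonglongrightarrow> l)"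
      by (auto simp: o_def)
  qed
  \<comment> \<open>The diagonal sequence is known to refine the extraction made for coordinate
    \<open>i\<close> only from index \<open>Suc i\<close> on. The offset is dropped afterwards,
    since it does not affect convergence.\<close>
  have "\<exists>l. (\<lambda>k. w (diagseq (k + Suc i)) i) \<longlonglongrightarrow> l" for i
  proof -
    have "\<exists>l. (\<lambda>k. w ((diagseq \<circ> ((+) (Suc i))) k) i) \<longlonglongrightarrow> l"
    proof (rule diagseq_holds)
      fix n and r s :: "nat \<Rightarrow> nat"
      assume "strict_mono r" "\<exists>l. (\<lambda>k. w (s k) n) \<longlonglongrightarrow> l"
      then show "\<exists>l. (\<lambda>k. w ((s \<circ> r) k) n) \<longlonglongrightarrow> l"
        using LIMSEQ_subseq_LIMSEQ unfolding o_def by blast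
    qed
    then show ?thesis by (simp add: o_def add.commute)
  qed
  then have "\<exists>l. (\<lambda>k. w (diagseq k) i) \<longlonglongrightarrow> l" for i
    using LIMSEQ_offset[of "\<lambda>k. w (diagseq k) i" "Suc i"] by blast
  then obtain l where "\<forall>i. (\<lambda>k. w (diagseq k) i) \<longlonglongrightarrow> l i"
    using choice[of "\<lambda>i l. (\<lambda>k. w (diagseq k) i) \<longlonglongrightarrow> l"] by auto
  with subseq_diagseq show ?thesis by (intro exI conjI)
qed

section \<open>Orbit closures and almost periodic points\<close>

definition orbit_closure :: "('g \<Rightarrow> 'x \<Rightarrow> 'x::topological_space) \<Rightarrow> 'x \<Rightarrow> 'x set" where
  "orbit_closure act p = closure (range (\<lambda>g. act g p))"

definition hitting_times :: "('g \<Rightarrow> 'x \<Rightarrow> 'x) \<Rightarrow> 'x set \<Rightarrow> 'x set \<Rightarrow> 'g set" where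
  "hitting_times act U V = {g. \<exists>z\<in>U. act g z \<in> V}"

locale g_system =
  fixes act :: "'g::group_add \<Rightarrow> 'x::metric_space \<Rightarrow> 'x"
  assumes G_system: "G_system act"
begin

lemma compact_UNIV: "compact (UNIV :: 'x set)"
  and act_0: "act 0 x = x"
  and act_add: "act (g + f) x = act g (act f x)"
  and cont: "continuous_on UNIV (act g)"
  using G_system unfolding G_system_def by auto

lemma open_preimage: "open W \<Longrightarrow> open {z. act g z \<in> W}"
  using open_vimage[OF _ cont, of W g] by (simp add: vimage_def)

lemma closed_preimage: "closed W \<Longrightarrow> closed {z. act g z \<in> W}"
  using closed_vimage[OF _ cont, of W g] by (simp add: vimage_def)

lemma act_in_orbit_closure: "act g p \<in> orbit_closure act p"
  unfolding orbit_closure_def by (rule subsetD[OF closure_subset rangeI])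

lemma self_in_orbit_closure: "p \<in> orbit_closure act p"
  using act_in_orbit_closure[of 0 p] by (simp add: act_0)

lemma orbit_closure_subset:
  assumes "closed C" "G_invariant act C" "p \<in> C"
  shows "orbit_closure act p \<subseteq> C"
  unfolding orbit_closure_def using assms by (intro closure_minimal) (auto simp: G_invariant_def)

lemma closed_orbit_closure: "closed (orbit_closure act p)"
  by (simp add: orbit_closure_def)

lemma G_invariant_orbit_closure: "G_invariant act (orbit_closure act p)"
  unfolding G_invariant_def
proof
  fix g
  let ?C = "orbit_closure act p"
  have "range (\<lambda>f. act f p) \<subseteq> {z. act g z \<in> ?C}"
    unfolding orbit_closure_def
    by (auto simp: act_add[symmetric] intro!: subsetD[OF closure_subset])
  then have "?C \<subseteq> {z. act g z \<in> ?C}"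
    unfolding orbit_closure_def[of act p]
    by (intro closure_minimal closed_preimage) auto
  then show "act g ` ?C \<subseteq> ?C" by auto
qed

lemma orbit_closure_mono: "q \<in> orbit_closure act p \<Longrightarrow> orbit_closure act q \<subseteq> orbit_closure act p"
  by (intro orbit_closure_subset closed_orbit_closure G_invariant_orbit_closure)

lemma orbit_meets_open:
  assumes "open U" "U \<inter> orbit_closure act p \<noteq> {}"
  shows "\<exists>g. act g p \<in> U"
  using assms unfolding orbit_closure_def by (auto simp: open_Int_closure_eq_empty)

text \<open>Syndeticity gives a finite \<open>F\<close> such that every point of the orbit of
  \<open>p\<close> is sent back near \<open>p\<close> by some \<open>f \<in> F\<close>. With closed
  balls this is a finite union of closed conditions, so it passes to the limit point
  \<open>q\<close>.\<close>

lemma almost_periodic_orbit_closure_sym: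
  assumes p: "almost_periodic act p" and q: "q \<in> orbit_closure act p"
  shows "p \<in> orbit_closure act q"
  unfolding orbit_closure_def closure_approachable_le
proof (intro allI impI)
  fix \<epsilon> :: real assume "\<epsilon> > 0"
  then have "p \<in> interior (cball p \<epsilon>)"
    by (intro interiorI[of "ball p \<epsilon>"]) auto
  then obtain F where F: "finite F" "\<And>g. \<exists>f\<in>F. act (f + g) p \<in> cball p \<epsilon>"
    using p unfolding almost_periodic_def syndetic_iff by (metis mem_Collect_eq)
  have "orbit_closure act p \<subseteq> (\<Union>f\<in>F. {z. act f z \<in> cball p \<epsilon>})"
    unfolding orbit_closure_def
  proof (intro closure_minimal closed_UN closed_preimage closed_cball F(1) ballI subsetI)
    fix z assume "z \<in> range (\<lambda>g. act g p)"
    then show "z \<in> (\<Union>f\<in>F. {z. act f z \<in> cball p \<epsilon>})"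
      using F(2) by (auto simp: act_add)
  qed
  then obtain f where "act f q \<in> cball p \<epsilon>" using q by blast
  then show "\<exists>z\<in>range (\<lambda>g. act g q). dist z p \<le> \<epsilon>" by (auto simp: dist_commute)
qed

lemma almost_periodic_orbit_closure_eq:
  assumes "almost_periodic act p" "q \<in> orbit_closure act p"
  shows "orbit_closure act q = orbit_closure act p"
  using orbit_closure_mono[OF assms(2)]
    orbit_closure_mono[OF almost_periodic_orbit_closure_sym[OF assms]] by (rule subset_antisym)

lemma minimal_orbit_closure:
  assumes "almost_periodic act p"
  shows "minimal_subset act (orbit_closure act p)"
  unfolding minimal_subset_def
proof (intro conjI ballI)
  show "orbit_closure act p \<noteq> {}" using self_in_orbit_closure[of p] by (metis empty_iff)
  show "closure (range (\<lambda>g. act g q)) = orbit_closure act p" if "q \<in> orbit_closure act p" for q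
    using almost_periodic_orbit_closure_eq[OF assms that] by (simp only: orbit_closure_def)
qed (fact closed_orbit_closure G_invariant_orbit_closure)+

lemma almost_periodic_orbit_closures_disjoint:
  assumes "almost_periodic act p" "almost_periodic act q"
    and "orbit_closure act p \<noteq> orbit_closure act q"
  shows "orbit_closure act p \<inter> orbit_closure act q = {}"
proof (rule equals0I)
  fix z assume "z \<in> orbit_closure act p \<inter> orbit_closure act q"
  then have "z \<in> orbit_closure act p" "z \<in> orbit_closure act q" by simp_all
  from this[THEN almost_periodic_orbit_closure_eq[rotated]] assms show False by simp
qed

text \<open>A finite union of these orbit closures would be closed, hence would contain all of
  \<open>\<Lambda>\<close> by density, and in particular \<open>y\<close>. Then
  \<open>\<Lambda>\<close> would be the orbit closure of a single almost periodic point, which is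
  minimal.\<close>

lemma infinite_almost_periodic_orbit_closures:
  assumes trans: "orbit_closure act y = \<Lambda>"
    and dense: "\<Lambda> \<subseteq> closure {p \<in> \<Lambda>. almost_periodic act p}"
    and nonmin: "\<not> minimal_subset act \<Lambda>"
  shows "infinite (orbit_closure act ` {p \<in> \<Lambda>. almost_periodic act p})"
proof
  let ?A = "{p \<in> \<Lambda>. almost_periodic act p}"
  assume fin: "finite (orbit_closure act ` ?A)"
  have "closure ?A \<subseteq> \<Union>(orbit_closure act ` ?A)"
    using fin self_in_orbit_closure
    by (intro closure_minimal closed_Union) (auto simp: closed_orbit_closure)
  then obtain p where p: "almost_periodic act p" "y \<in> orbit_closure act p"
    using dense self_in_orbit_closure[of y] trans by blast
  then have "orbit_closure act p = \<Lambda>"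
    using almost_periodic_orbit_closure_eq trans by blast
  with minimal_orbit_closure[OF p(1)] nonmin show False by simp
qed

section \<open>Hitting times of open sets\<close>

lemma syndetic_hitting_times:
  assumes trans: "orbit_closure act y = \<Lambda>"
    and dense: "\<Lambda> \<subseteq> closure {p \<in> \<Lambda>. almost_periodic act p}"
    and U: "open U" "U \<inter> \<Lambda> \<noteq> {}" and V: "open V" "V \<inter> \<Lambda> \<noteq> {}"
  shows "syndetic (hitting_times act U V)"
proof -
  obtain a b where a: "act a y \<in> U" and b: "act b y \<in> V"
    using orbit_meets_open[of U y] orbit_meets_open[of V y] U V trans by metis
  \<comment> \<open>Since \<open>b - a\<close> sends \<open>act a y\<close> to
    \<open>act b y\<close>, this open set meets \<open>\<Lambda>\<close> and so contains an almost
    periodic \<open>p\<close>. Each return of \<open>p\<close> to it, followed by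
    \<open>b - a\<close>, takes the point \<open>p\<close> of \<open>U\<close> into
    \<open>V\<close>.\<close>
  let ?O = "U \<inter> {z. act (b - a) z \<in> V}"
  have O: "open ?O" using U V by (intro open_Int open_preimage)
  have "act (b - a) (act a y) = act b y" by (simp add: act_add[symmetric])
  then have "act a y \<in> ?O" using a b by simp
  moreover have "act a y \<in> \<Lambda>" using trans act_in_orbit_closure by blast
  ultimately have "?O \<inter> closure {p \<in> \<Lambda>. almost_periodic act p} \<noteq> {}" using dense by blast
  then obtain p where p: "p \<in> ?O" "almost_periodic act p"
    using open_Int_closure_eq_empty[OF O] by blast
  have "p \<in> interior ?O" by (subst interior_open[OF O]) (rule p(1))
  then have "syndetic {g. act g p \<in> ?O}"
    using p(2) unfolding almost_periodic_def by blast
  then have "syndetic ((+) (b - a) ` {g. act g p \<in> ?O})" by (rule syndetic_translate)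
  then show ?thesis
  proof (rule syndetic_mono)
    show "(+) (b - a) ` {g. act g p \<in> ?O} \<subseteq> hitting_times act U V"
      using p(1) unfolding hitting_times_def by (auto simp: act_add simp del: diff_add_eq)
  qed
qed

text \<open>Invariance keeps \<open>M\<close> inside the preimages of \<open>W\<close> under all
  \<open>e \<in> E\<close>. Their intersection is therefore an open set meeting
  \<open>\<Lambda>\<close>, and a time \<open>g\<close> hitting it makes every \<open>e + g\<close>
  hit \<open>W\<close>.\<close>

lemma thickly_syndetic_hitting_times:
  assumes trans: "orbit_closure act y = \<Lambda>"
    and dense: "\<Lambda> \<subseteq> closure {p \<in> \<Lambda>. almost_periodic act p}"
    and U: "open U" "U \<inter> \<Lambda> \<noteq> {}"
    and W: "open W" "M \<subseteq> W"
    and M: "G_invariant act M" "M \<noteq> {}" "M \<subseteq> \<Lambda>"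
  shows "thickly_syndetic (hitting_times act U W)"
  unfolding thickly_syndetic_def
proof (intro allI impI)
  fix E :: "'g set" assume E: "finite E"
  let ?W = "\<Inter>e\<in>E. {z. act e z \<in> W}"
  have "open ?W" using E W by (intro open_INT ballI open_preimage)
  moreover have "M \<subseteq> ?W" using M(1) W(2) by (auto simp: G_invariant_def)
  then have "?W \<inter> \<Lambda> \<noteq> {}" using M by blast
  ultimately have "syndetic (hitting_times act U ?W)"
    using syndetic_hitting_times[OF trans dense U] by blast
  then show "syndetic {g. \<forall>e\<in>E. e + g \<in> hitting_times act U W}"
  proof (rule syndetic_mono)
    show "hitting_times act U ?W \<subseteq> {g. \<forall>e\<in>E. e + g \<in> hitting_times act U W}"
      unfolding hitting_times_def by (force simp: act_add)
  qed
qed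

lemma ex_simultaneous_hit:
  assumes trans: "orbit_closure act y = \<Lambda>"
    and dense: "\<Lambda> \<subseteq> closure {p \<in> \<Lambda>. almost_periodic act p}"
    and U: "open U" "U \<inter> \<Lambda> \<noteq> {}"
    and I: "finite I"
    and W: "\<And>i. i \<in> I \<Longrightarrow> open (W i)" "\<And>i. i \<in> I \<Longrightarrow> M i \<subseteq> W i"
    and M: "\<And>i. i \<in> I \<Longrightarrow> G_invariant act (M i)" "\<And>i. i \<in> I \<Longrightarrow> M i \<noteq> {}"
      "\<And>i. i \<in> I \<Longrightarrow> M i \<subseteq> \<Lambda>"
  shows "\<exists>g. \<forall>i\<in>I. \<exists>z\<in>U. act g z \<in> W i"
proof -
  have "thickly_syndetic (\<Inter>i\<in>I. hitting_times act U (W i))"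
    using W M by (intro thickly_syndetic_INT[OF I] thickly_syndetic_hitting_times[OF trans dense U])
  then have "syndetic (\<Inter>i\<in>I. hitting_times act U (W i))"
    by (rule thickly_syndetic_imp_syndetic)
  then show ?thesis unfolding syndetic_iff hitting_times_def by blast
qed

section \<open>Construction of the infinite set \<open>K\<close> from limits of simultaneous
  hits\<close>

lemma ex_infinite_sensitive_set:
  assumes trans: "orbit_closure act y = \<Lambda>"
    and dense: "\<Lambda> \<subseteq> closure {p \<in> \<Lambda>. almost_periodic act p}"
    and nonmin: "\<not> minimal_subset act \<Lambda>"
  shows "\<exists>K. K \<subseteq> \<Lambda> \<and> infinite K \<and> countable K \<and>
    (\<forall>T V U. finite T \<longrightarrow> T \<subseteq> K \<longrightarrow> open U \<longrightarrow> U \<inter> \<Lambda> \<noteq> {} \<longrightarrow>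
       (\<forall>t\<in>T. open (V t) \<and> t \<in> V t) \<longrightarrow> (\<exists>g. \<forall>t\<in>T. \<exists>z\<in>U. act g z \<in> V t))"
proof -
  let ?A = "{p \<in> \<Lambda>. almost_periodic act p}"
  have cl: "closed \<Lambda>" and inv: "G_invariant act \<Lambda>"
    using closed_orbit_closure[of y] G_invariant_orbit_closure[of y] trans by simp_all
  obtain M :: "nat \<Rightarrow> 'x set" where M: "inj M" "range M \<subseteq> orbit_closure act ` ?A"
    using infinite_countable_subset[OF infinite_almost_periodic_orbit_closures[OF assms]] by blast
  have ex_p: "\<exists>p\<in>?A. M i = orbit_closure act p" for i using M(2) by blast
  have M_closed: "closed (M i)" and M_inv: "G_invariant act (M i)" and M_ne: "M i \<noteq> {}"
    and M_sub: "M i \<subseteq> \<Lambda>" for i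
  proof -
    obtain p where p: "p \<in> \<Lambda>" "M i = orbit_closure act p" using ex_p by blast
    show "closed (M i)" "G_invariant act (M i)" "M i \<noteq> {}" "M i \<subseteq> \<Lambda>"
      using closed_orbit_closure[of p] G_invariant_orbit_closure[of p] self_in_orbit_closure[of p]
        orbit_closure_subset[OF cl inv p(1)] by (auto simp: p(2))
  qed
  have M_disj: "M i \<inter> M j = {}" if "i \<noteq> j" for i j
  proof -
    obtain p q where "almost_periodic act p" "M i = orbit_closure act p"
      "almost_periodic act q" "M j = orbit_closure act q"
      using ex_p[of i] ex_p[of j] by blast
    then show ?thesis
      using almost_periodic_orbit_closures_disjoint[of p q] injD[OF M(1), of i j] that by metis
  qed
  define \<delta> :: "nat \<Rightarrow> real" where "\<delta> k = 1 / real (Suc k)" for k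
  have \<delta>_pos: "\<delta> k > 0" for k by (simp add: \<delta>_def)
  have y: "y \<in> \<Lambda>" using trans self_in_orbit_closure by blast
  have "\<exists>g. \<forall>i\<in>{..k}. \<exists>z\<in>ball y (\<delta> k). act g z \<in> (\<Union>m\<in>M i. ball m (\<delta> k))" for k
  proof (rule ex_simultaneous_hit[OF trans dense])
    show "ball y (\<delta> k) \<inter> \<Lambda> \<noteq> {}" using y \<delta>_pos[of k] centre_in_ball by blast
    show "M i \<subseteq> (\<Union>m\<in>M i. ball m (\<delta> k))" for i using \<delta>_pos[of k] by auto
  qed (use M_inv M_ne M_sub in auto)
  \<comment> \<open>The starting point \<open>z k i\<close> may vary with \<open>i\<close>, while
    \<open>g k\<close> serves all \<open>i \<le> k\<close> at once. Nothing is known for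
    \<open>i > k\<close>.\<close>
  then obtain g z where
    gz: "\<And>k i. i \<le> k \<Longrightarrow> z k i \<in> ball y (\<delta> k)
           \<and> act (g k) (z k i) \<in> (\<Union>m\<in>M i. ball m (\<delta> k))"
    by (metis atMost_iff)
  obtain r l where r: "strict_mono r"
    and l: "\<And>i. (\<lambda>k. act (g (r k)) (z (r k) i)) \<longlonglongrightarrow> l i"
    using diagonal_convergent_subsequence[OF compact_UNIV, of "\<lambda>k i. act (g k) (z k i)"] by blast
  \<comment> \<open>Each fixed coordinate \<open>i\<close> is thus eventually among the controlled
    ones.\<close>
  have ge_r: "\<forall>\<^sub>F k in sequentially. i \<le> r k" for i
    using filterlim_subseq[OF r] by (simp add: filterlim_at_top)
  have \<delta>_small: "\<forall>\<^sub>F k in sequentially. \<delta> (r k) < \<epsilon>" if "\<epsilon> > 0" for \<epsilon>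
  proof -
    have "\<delta> \<longlonglongrightarrow> 0"
      unfolding \<delta>_def using LIMSEQ_inverse_real_of_nat by (simp add: inverse_eq_divide)
    then have "(\<delta> \<circ> r) \<longlonglongrightarrow> 0" using r by (rule LIMSEQ_subseq_LIMSEQ)
    then show ?thesis using that order_tendstoD(2) by fastforce
  qed
  \<comment> \<open>The images lie within \<open>\<delta> (r k)\<close> of \<open>M i\<close> and
    tend to \<open>l i\<close>, and \<open>M i\<close> is closed.\<close>
  have l_in: "l i \<in> M i" for i
  proof -
    have "\<exists>m\<in>M i. dist m (l i) < \<epsilon>" if "\<epsilon> > 0" for \<epsilon>
    proof -
      have "\<forall>\<^sub>F k in sequentially. dist (act (g (r k)) (z (r k) i)) (l i) < \<epsilon> / 2"
        using l tendstoD that half_gt_zero by blast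
      moreover have "\<forall>\<^sub>F k in sequentially. \<delta> (r k) < \<epsilon> / 2"
        using \<delta>_small that half_gt_zero by blast
      ultimately have "\<forall>\<^sub>F k in sequentially. \<exists>m\<in>M i. dist m (l i) < \<epsilon>"
        using ge_r[of i]
      proof eventually_elim
        case (elim k)
        then obtain m where "m \<in> M i" "dist m (act (g (r k)) (z (r k) i)) < \<delta> (r k)"
          using gz[of i "r k"] by auto
        then show ?case
          using elim dist_triangle[of m "l i" "act (g (r k)) (z (r k) i)"] by force
      qed
      then show ?thesis by (simp add: eventually_sequentially) blast
    qed
    then show ?thesis using M_closed closure_approachable[of "l i" "M i"] by simp
  qed
  \<comment> \<open>Disjointness of the \<open>M i\<close> makes the limits distinct, so that
    \<open>range l\<close> is infinite.\<close>
  have "inj l" using l_in M_disj by (metis IntI empty_iff injI)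
  show ?thesis
  proof (intro exI[of _ "range l"] conjI allI impI)
    show "range l \<subseteq> \<Lambda>" using l_in M_sub by blast
    show "infinite (range l)" using \<open>inj l\<close> by (simp add: finite_image_iff)
    show "countable (range l)" by simp
    \<comment> \<open>Finite sets \<open>T\<close> with neighbourhoods indexed by their points
      replace the tuples of the final statement, and an open \<open>U\<close> meeting
      \<open>\<Lambda>\<close> replaces a neighbourhood of a point.\<close>
    fix T V U
    assume T: "finite T" "T \<subseteq> range l" and U: "open U" "U \<inter> \<Lambda> \<noteq> {}"
      and V: "\<forall>t\<in>T. open (V t) \<and> t \<in> V t"
    obtain h where h: "act h y \<in> U" using orbit_meets_open[OF U(1)] U(2) trans by blast
    obtain \<epsilon> where \<epsilon>: "\<epsilon> > 0" "ball y \<epsilon> \<subseteq> {z. act h z \<in> U}"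
      using open_preimage[OF U(1), of h] h unfolding open_contains_ball by blast
    obtain J where J: "finite J" "T = l ` J"
      using finite_subset_image[OF T] by auto
    \<comment> \<open>Finiteness of \<open>J\<close> allows one stage \<open>k\<close> for all
      targets.\<close>
    have "\<forall>\<^sub>F k in sequentially. \<forall>i\<in>J. act (g (r k)) (z (r k) i) \<in> V (l i) \<and> i \<le> r k"
      using J V ge_r topological_tendstoD[OF l]
      by (intro eventually_ball_finite ballI eventually_conj) auto
    then have "\<forall>\<^sub>F k in sequentially. \<exists>g. \<forall>t\<in>T. \<exists>z\<in>U. act g z \<in> V t"
      using \<delta>_small[OF \<epsilon>(1)]
    proof eventually_elim
      case (elim k)
      \<comment> \<open>The witness is \<open>act h (z (r k) i)\<close>: \<open>h\<close> carries
        the ball around \<open>y\<close> into \<open>U\<close>, and \<open>g (r k) - h\<close>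
        undoes \<open>h\<close> before applying \<open>g (r k)\<close>.\<close>
      have "\<exists>z'\<in>U. act (g (r k) - h) z' \<in> V (l i)" if "i \<in> J" for i
      proof
        have "z (r k) i \<in> ball y \<epsilon>" using gz[of i "r k"] elim that by force
        then show "act h (z (r k) i) \<in> U" using \<epsilon>(2) by blast
        show "act (g (r k) - h) (act h (z (r k) i)) \<in> V (l i)"
          using elim that by (simp add: act_add[symmetric])
      qed
      then show ?case using J(2) by blast
    qed
    then show "\<exists>g. \<forall>t\<in>T. \<exists>z\<in>U. act g z \<in> V t" by (simp add: eventually_sequentially) blast
  qed
qed

section \<open>From centers of attraction to transitivity, and the final theorem\<close>

lemma center_of_attraction_orbit_closure:
  fixes F :: "'d::preorder \<Rightarrow> 'g set"
  assumes "folner_net F"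
  shows "center_of_attraction F act y (orbit_closure act y)"
proof -
  have F: "\<exists>c. a \<le> c \<and> b \<le> c" "finite (F n)" "F n \<noteq> {}" for a b :: 'd and n
    using assms unfolding folner_net_def by blast+
  have "has_density F UNIV 1"
    using F(2,3) by (subst has_density_1_iff[of F, OF F]) (auto intro: less_imp_le)
  moreover have "{g. act g y \<in> (\<Union>c\<in>orbit_closure act y. ball c \<epsilon>)} = UNIV"
    if "\<epsilon> > 0" for \<epsilon>
  proof -
    have "act g y \<in> (\<Union>c\<in>orbit_closure act y. ball c \<epsilon>)" for g
      using UN_I[OF act_in_orbit_closure[of g y], of "act g y" "\<lambda>c. ball c \<epsilon>"] that by simp
    then show ?thesis by blast
  qed
  ultimately show ?thesis
    unfolding center_of_attraction_def using closed_orbit_closure[of y] by metis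
qed

text \<open>Being closed, invariant and containing \<open>y\<close>, the center includes the orbit
  closure of \<open>y\<close>. That closure is also a center of attraction, so minimality rules out
  a proper inclusion.\<close>

lemma S_generic_orbit_closure:
  assumes F: "folner_net F" and gen: "S_generic F act \<Lambda>"
  shows "\<exists>y. orbit_closure act y = \<Lambda>"
proof -
  obtain y where y: "y \<in> \<Lambda>" "\<Lambda> = min_center F act y" and inv: "G_invariant act \<Lambda>"
    using gen unfolding S_generic_def by blast
  have "minimal_center_of_attraction F act y \<Lambda>"
    unfolding y(2) min_center_def
    by (rule theI'[OF ex1_minimal_center_of_attraction[OF G_system F]])
  then have "closed \<Lambda>" and min: "\<not> orbit_closure act y \<subset> \<Lambda>"
    using center_of_attraction_orbit_closure[OF F]
    unfolding minimal_center_of_attraction_def center_of_attraction_def by blast+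
  then have "orbit_closure act y \<subseteq> \<Lambda>" using inv y(1) by (intro orbit_closure_subset)
  with min show ?thesis by blast
qed

end

theorem theorem1p6:
  fixes act :: "'g::ab_group_add \<Rightarrow> 'x::metric_space \<Rightarrow> 'x"
    and F :: "'d::preorder \<Rightarrow> 'g set"
    and x :: 'x
  assumes "infinite (UNIV :: 'g set)"
    and "G_system act"
    and "folner_net F"
    and "S_generic F act (min_center F act x)"
    and "\<not> minimal_subset act (min_center F act x)"
    and "min_center F act x \<subseteq> closure {p \<in> min_center F act x. almost_periodic act p}"
  shows "\<exists>K. K \<subseteq> min_center F act x \<and> infinite K \<and> countable K \<and>
    (\<forall>xhat \<in> min_center F act x. \<forall>n\<ge>2. \<forall>xs :: nat \<Rightarrow> 'x. \<forall>U. \<forall>V :: nat \<Rightarrow> 'x set.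
       xs ` {1..n} \<subseteq> K \<longrightarrow> inj_on xs {1..n} \<longrightarrow>
       xhat \<in> interior U \<longrightarrow> (\<forall>i\<in>{1..n}. xs i \<in> interior (V i)) \<longrightarrow>
       (\<exists>ys :: nat \<Rightarrow> 'x. \<exists>g. (\<forall>i\<in>{1..n}. ys i \<in> U) \<and> (\<forall>i\<in>{1..n}. act g (ys i) \<in> V i)))"
proof -
  let ?\<Lambda> = "min_center F act x"
  interpret g_system act using assms(2) by unfold_locales
  obtain y where "orbit_closure act y = ?\<Lambda>"
    using S_generic_orbit_closure[OF assms(3,4)] by blast
  from ex_infinite_sensitive_set[OF this assms(6,5)] obtain K
    where "K \<subseteq> ?\<Lambda> \<and> infinite K \<and> countable K \<and>
      (\<forall>T V U. finite T \<longrightarrow> T \<subseteq> K \<longrightarrow> open U \<longrightarrow> U \<inter> ?\<Lambda> \<noteq> {} \<longrightarrow>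
        (\<forall>t\<in>T. open (V t) \<and> t \<in> V t) \<longrightarrow> (\<exists>g. \<forall>t\<in>T. \<exists>z\<in>U. act g z \<in> V t))"
    by (rule exE)
  then have K: "K \<subseteq> ?\<Lambda>" "infinite K" "countable K"
    and hit: "\<And>T V U. finite T \<Longrightarrow> T \<subseteq> K \<Longrightarrow> open U \<Longrightarrow> U \<inter> ?\<Lambda> \<noteq> {} \<Longrightarrow>
      \<forall>t\<in>T. open (V t) \<and> t \<in> V t \<Longrightarrow> \<exists>g. \<forall>t\<in>T. \<exists>z\<in>U. act g z \<in> V t"
    by simp_all
  have sensitive: "\<exists>ys g. (\<forall>i\<in>{1..n}. ys i \<in> U) \<and> (\<forall>i\<in>{1..n}. act g (ys i) \<in> V i)"
    if xhat: "xhat \<in> ?\<Lambda>" "xhat \<in> interior U" and xs: "xs ` {1..n} \<subseteq> K" "inj_on xs {1..n}"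
      and V: "\<forall>i\<in>{1..n}. xs i \<in> interior (V i)"
    for xhat n xs U and V :: "nat \<Rightarrow> 'x set"
  proof -
    \<comment> \<open>The fact \<open>hit\<close> expects neighbourhoods indexed by points of
      \<open>K\<close>. Since \<open>xs\<close> is injective, \<open>V\<close> can be reindexed
      through its inverse; interiors supply the open sets required.\<close>
    let ?inv = "the_inv_into {1..n} xs"
    have inv: "?inv (xs i) = i" if "i \<in> {1..n}" for i
      using the_inv_into_f_f[OF xs(2) that] .
    have "\<exists>g. \<forall>t\<in>xs ` {1..n}. \<exists>z\<in>interior U. act g z \<in> interior (V (?inv t))"
    proof (rule hit)
      show "interior U \<inter> ?\<Lambda> \<noteq> {}" using xhat by blast
      show "\<forall>t\<in>xs ` {1..n}. open (interior (V (?inv t))) \<and> t \<in> interior (V (?inv t))"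
        using V inv by simp
    qed (use xs(1) in simp_all)
    then obtain g where "\<forall>i\<in>{1..n}. \<exists>z\<in>interior U. act g z \<in> interior (V i)"
      using inv by auto
    then obtain ys where "\<forall>i\<in>{1..n}. ys i \<in> interior U \<and> act g (ys i) \<in> interior (V i)"
      by metis
    then show ?thesis by (meson interior_subset subsetD)
  qed
  show ?thesis
    by (intro exI[of _ K] conjI K ballI allI impI) (rule sensitive)
qed

end
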